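(* Let $S$ be a finite set of jobs with processing times $p_j\ge0$ and weights $w_j\ge 0$, and let $p(S)=\sum_{j\in S}p_j>0$. Suppose $h\colon[0,\infty)\to[0,\infty)$ is a non-decreasing concave function, given by a value oracle, with $h(0)=0$ and $h(t)>0$ for $t>0$. Then there is a schedule for $1||\sum w_j h(C_j)$ that can be computed in strongly polynomial time and approximates an optimal schedule with approximation ratio $\frac{2}{2-\kappa_f}$, where the parameter $\kappa_f$ is given by \[ 1-\kappa_f=\lim_{y\to p(S)^-}\frac{h(p(S))-h(y)}{h(p(S)-y)}=\frac{h'(p(S))}{h'(0)}, \] the second equality holding if $h$ is differentiable at $0$ and at $p(S)$.
   Context: In $1||\sum w_jh(C_j)$ the jobs are processed one at a time on a single machine in some order; the completion time $C_j$ of job $j$ is the sum of its own processing time and the processing times of all jobs preceding it in the order. The objective is to choose an order minimizing $\sum_{j\in S}w_jh(C_j)$. A schedule has approximation ratio $\alpha$ if its objective value is at most $\alpha$ times the minimum. Differentiability at $0$ is one-sided. Strongly polynomial time means that the number of oracle calls and elementary arithmetic operations is bounded by a polynomial in $|S|$. *)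

theory Defs
  imports
    "HOL-Analysis.Analysis"
    "HOL-Combinatorics.Multiset_Permutations"
    "HOL-Computational_Algebra.Polynomial"
begin

section \<open>Scheduling on a single machine\<close>

text \<open>
  A schedule of a set of jobs \<open>S\<close> is an element of \<^term>\<open>permutations_of_set S\<close>, i.e. a list
  that contains every job of \<open>S\<close> exactly once, in processing order.
\<close>

definition completion_time :: "('a \<Rightarrow> real) \<Rightarrow> 'a list \<Rightarrow> 'a \<Rightarrow> real" where
  "completion_time p \<sigma> j = (\<Sum>k\<leftarrow>takeWhile (\<lambda>k. k \<noteq> j) \<sigma>. p k) + p j"

definition objective ::
    "'a set \<Rightarrow> ('a \<Rightarrow> real) \<Rightarrow> ('a \<Rightarrow> real) \<Rightarrow> (real \<Rightarrow> real) \<Rightarrow> 'a list \<Rightarrow> real" where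
  "objective S p w h \<sigma> = (\<Sum>j\<in>S. w j * h (completion_time p \<sigma> j))"

definition opt :: "'a set \<Rightarrow> ('a \<Rightarrow> real) \<Rightarrow> ('a \<Rightarrow> real) \<Rightarrow> (real \<Rightarrow> real) \<Rightarrow> real" where
  "opt S p w h = (MIN \<sigma>\<in>permutations_of_set S. objective S p w h \<sigma>)"

definition has_approx_ratio ::
    "real \<Rightarrow> 'a set \<Rightarrow> ('a \<Rightarrow> real) \<Rightarrow> ('a \<Rightarrow> real) \<Rightarrow> (real \<Rightarrow> real) \<Rightarrow> 'a list \<Rightarrow> bool" where
  "has_approx_ratio \<alpha> S p w h \<sigma> \<longleftrightarrow>
     \<sigma> \<in> permutations_of_set S \<and> objective S p w h \<sigma> \<le> \<alpha> * opt S p w h"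

definition valid_jobs :: "'a set \<Rightarrow> ('a \<Rightarrow> real) \<Rightarrow> ('a \<Rightarrow> real) \<Rightarrow> bool" where
  "valid_jobs S p w \<longleftrightarrow> finite S \<and> (\<forall>j\<in>S. p j \<ge> 0 \<and> w j \<ge> 0) \<and> sum p S > 0"

text \<open>A function on \<open>[0,\<infinity>)\<close> is a total function whose values at negative arguments are irrelevant.\<close>

definition concave_cost :: "(real \<Rightarrow> real) \<Rightarrow> bool" where
  "concave_cost h \<longleftrightarrow>
     mono_on {0..} h \<and> concave_on {0..} h \<and> h 0 = 0 \<and> (\<forall>t>0. h t > 0)"

definition curvature_quotient :: "(real \<Rightarrow> real) \<Rightarrow> real \<Rightarrow> real \<Rightarrow> real" where
  "curvature_quotient h P y = (h P - h y) / h (P - y)"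

text \<open>\<^const>\<open>Lim\<close> is unspecified if the limit does not exist, so that existence has to be stated separately.\<close>

definition curvature :: "(real \<Rightarrow> real) \<Rightarrow> real \<Rightarrow> real" where
  "curvature h P = 1 - Lim (at_left P) (curvature_quotient h P)"


section \<open>Programs over the reals with a value oracle\<close>

text \<open>
  A program operates on arrays of natural numbers, used for indices and addresses, and on arrays
  of reals; a scalar is cell \<open>0\<close> of an array.  Reals can only be accessed by field operations,
  comparisons and oracle queries.  There is no rounding and no conversion from reals to indices,
  no index multiplication, and no constants other than integers.
\<close>

type_synonym name = string

record state =
  ivar :: "name \<Rightarrow> nat \<Rightarrow> nat"
  rvar :: "name \<Rightarrow> nat \<Rightarrow> real"

datatype iexp =
    IConst nat
  | IGet name iexp
  | IPlus iexp iexp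
  | IMinus iexp iexp

datatype rexp =
    RConst int
  | RGet name iexp
  | RPlus rexp rexp
  | RMinus rexp rexp
  | RTimes rexp rexp
  | RDivide rexp rexp

datatype bexp =
    ILess iexp iexp
  | RLess rexp rexp
  | BNot bexp
  | BAnd bexp bexp

datatype com =
    Skip
  | IAssign name iexp iexp
  | RAssign name iexp rexp
  | Query name iexp rexp
  | Seq com com
  | Cond bexp com com
  | While bexp com

fun ival :: "iexp \<Rightarrow> state \<Rightarrow> nat" where
  "ival (IConst n) s = n"
| "ival (IGet x e) s = ivar s x (ival e s)"
| "ival (IPlus e1 e2) s = ival e1 s + ival e2 s"
| "ival (IMinus e1 e2) s = ival e1 s - ival e2 s"

text \<open>Division by zero yields \<open>0\<close>, which a program could also achieve by a preceding test.\<close>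

fun rval :: "rexp \<Rightarrow> state \<Rightarrow> real" where
  "rval (RConst k) s = of_int k"
| "rval (RGet x e) s = rvar s x (ival e s)"
| "rval (RPlus e1 e2) s = rval e1 s + rval e2 s"
| "rval (RMinus e1 e2) s = rval e1 s - rval e2 s"
| "rval (RTimes e1 e2) s = rval e1 s * rval e2 s"
| "rval (RDivide e1 e2) s = rval e1 s / rval e2 s"

fun bval :: "bexp \<Rightarrow> state \<Rightarrow> bool" where
  "bval (ILess e1 e2) s \<longleftrightarrow> ival e1 s < ival e2 s"
| "bval (RLess e1 e2) s \<longleftrightarrow> rval e1 s < rval e2 s"
| "bval (BNot b) s \<longleftrightarrow> \<not> bval b s"
| "bval (BAnd b1 b2) s \<longleftrightarrow> bval b1 s \<and> bval b2 s"

text \<open>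
  Running times charge one unit for every constant, memory access, arithmetic or Boolean
  operation, comparison, assignment, branch and oracle call.  They therefore bound the number of
  oracle calls and elementary arithmetic operations from above.
\<close>

fun itime :: "iexp \<Rightarrow> nat" where
  "itime (IConst n) = 1"
| "itime (IGet x e) = 1 + itime e"
| "itime (IPlus e1 e2) = 1 + itime e1 + itime e2"
| "itime (IMinus e1 e2) = 1 + itime e1 + itime e2"

fun rtime :: "rexp \<Rightarrow> nat" where
  "rtime (RConst k) = 1"
| "rtime (RGet x e) = 1 + itime e"
| "rtime (RPlus e1 e2) = 1 + rtime e1 + rtime e2"
| "rtime (RMinus e1 e2) = 1 + rtime e1 + rtime e2"
| "rtime (RTimes e1 e2) = 1 + rtime e1 + rtime e2"
| "rtime (RDivide e1 e2) = 1 + rtime e1 + rtime e2"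

fun btime :: "bexp \<Rightarrow> nat" where
  "btime (ILess e1 e2) = 1 + itime e1 + itime e2"
| "btime (RLess e1 e2) = 1 + rtime e1 + rtime e2"
| "btime (BNot b) = 1 + btime b"
| "btime (BAnd b1 b2) = 1 + btime b1 + btime b2"

definition set_ivar :: "name \<Rightarrow> nat \<Rightarrow> nat \<Rightarrow> state \<Rightarrow> state" where
  "set_ivar x i v s = s\<lparr>ivar := (ivar s)(x := (ivar s x)(i := v))\<rparr>"

definition set_rvar :: "name \<Rightarrow> nat \<Rightarrow> real \<Rightarrow> state \<Rightarrow> state" where
  "set_rvar x i v s = s\<lparr>rvar := (rvar s)(x := (rvar s x)(i := v))\<rparr>"

text \<open>
  \<open>exec h c s t s'\<close>: with value oracle \<open>h\<close>, program \<open>c\<close> started in \<open>s\<close> terminates in \<open>s'\<close> after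
  time \<open>t\<close>.  A query outside the domain \<open>[0,\<infinity>)\<close> of the oracle has no transition.
\<close>

inductive exec :: "(real \<Rightarrow> real) \<Rightarrow> com \<Rightarrow> state \<Rightarrow> nat \<Rightarrow> state \<Rightarrow> bool" for h where
  Skip: "exec h Skip s 1 s"
| IAssign: "exec h (IAssign x i e) s (1 + itime i + itime e) (set_ivar x (ival i s) (ival e s) s)"
| RAssign: "exec h (RAssign x i e) s (1 + itime i + rtime e) (set_rvar x (ival i s) (rval e s) s)"
| Query: "rval e s \<ge> 0 \<Longrightarrow>
    exec h (Query x i e) s (1 + itime i + rtime e) (set_rvar x (ival i s) (h (rval e s)) s)"
| Seq: "exec h c1 s t1 s' \<Longrightarrow> exec h c2 s' t2 s'' \<Longrightarrow> exec h (Seq c1 c2) s (t1 + t2) s''"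
| CondTrue: "bval b s \<Longrightarrow> exec h c1 s t s' \<Longrightarrow> exec h (Cond b c1 c2) s (1 + btime b + t) s'"
| CondFalse: "\<not> bval b s \<Longrightarrow> exec h c2 s t s' \<Longrightarrow> exec h (Cond b c1 c2) s (1 + btime b + t) s'"
| WhileFalse: "\<not> bval b s \<Longrightarrow> exec h (While b c) s (1 + btime b) s"
| WhileTrue: "bval b s \<Longrightarrow> exec h c s t1 s' \<Longrightarrow> exec h (While b c) s' t2 s'' \<Longrightarrow>
    exec h (While b c) s (1 + btime b + t1 + t2) s''"

inductive_cases Skip_elim: "exec h Skip s t s'"
inductive_cases IAssign_elim: "exec h (IAssign x i e) s t s'"
inductive_cases RAssign_elim: "exec h (RAssign x i e) s t s'"
inductive_cases Query_elim: "exec h (Query x i e) s t s'"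
inductive_cases Seq_elim: "exec h (Seq c1 c2) s t s'"
inductive_cases Cond_elim: "exec h (Cond b c1 c2) s t s'"
inductive_cases While_elim: "exec h (While b c) s t s'"

lemma exec_deterministic:
  assumes "exec h c s t1 s1" "exec h c s t2 s2"
  shows "t1 = t2 \<and> s1 = s2"
  using assms
proof (induction arbitrary: t2 s2 rule: exec.induct)
  case Skip then show ?case by (auto elim: Skip_elim)
next
  case IAssign then show ?case by (auto elim: IAssign_elim)
next
  case RAssign then show ?case by (auto elim: RAssign_elim)
next
  case Query from Query.prems show ?case by (auto elim: Query_elim)
next
  case (Seq c1 s t1 s' c2 u s'')
  from Seq.prems show ?case by (rule Seq_elim) (blast dest: Seq.IH)
next
  case (CondTrue b s c1 t s' c2)
  from CondTrue.prems show ?case by (rule Cond_elim) (auto simp: CondTrue.hyps dest: CondTrue.IH)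
next
  case (CondFalse b s c2 t s' c1)
  from CondFalse.prems show ?case by (rule Cond_elim) (auto simp: CondFalse.hyps dest: CondFalse.IH)
next
  case (WhileFalse b s c)
  from WhileFalse.prems show ?case by (rule While_elim) (auto simp: WhileFalse.hyps)
next
  case (WhileTrue b s c t1 s' u s'')
  from WhileTrue.prems show ?case
    by (rule While_elim) (auto simp: WhileTrue.hyps dest!: WhileTrue.IH)
qed

text \<open>
  The input is an enumeration \<open>js\<close> of the jobs: the number of jobs is in \<open>n\<close>, and the processing
  time and weight of job \<open>js ! i\<close> are in cell \<open>i\<close> of \<open>p\<close> and \<open>w\<close>.  All other cells are \<open>0\<close>.  The
  output is read from the array \<open>out\<close>, whose cell \<open>i\<close> holds the index into \<open>js\<close> of the job
  processed at position \<open>i\<close>.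
\<close>

definition input_state :: "('a \<Rightarrow> real) \<Rightarrow> ('a \<Rightarrow> real) \<Rightarrow> 'a list \<Rightarrow> state" where
  "input_state p w js = \<lparr>
     ivar = (\<lambda>x i. if x = ''n'' \<and> i = 0 then length js else 0),
     rvar = (\<lambda>x i. if i < length js then
                     if x = ''p'' then p (js ! i) else if x = ''w'' then w (js ! i) else 0
                   else 0)\<rparr>"

definition outputs :: "state \<Rightarrow> 'a list \<Rightarrow> 'a list \<Rightarrow> bool" where
  "outputs s js \<sigma> \<longleftrightarrow>
     (\<forall>i<length js. ivar s ''out'' i < length js) \<and>
     \<sigma> = map (\<lambda>i. js ! ivar s ''out'' i) [0..<length js]"

definition computes_within ::
    "com \<Rightarrow> (real \<Rightarrow> real) \<Rightarrow> ('a \<Rightarrow> real) \<Rightarrow> ('a \<Rightarrow> real) \<Rightarrow> 'a list \<Rightarrow> nat \<Rightarrow> 'a list \<Rightarrow> bool" where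
  "computes_within c h p w js T \<sigma> \<longleftrightarrow>
     (\<exists>t s. exec h c (input_state p w js) t s \<and> t \<le> T \<and> outputs s js \<sigma>)"

end

theory Submission
  imports Defs
begin

text \<open>
  Smith's rule has the required ratio, so sorting suffices and the oracle is never queried.

  Put \<open>c = 1 - \<kappa>\<close> and \<open>H x = \<integral> h\<close> over \<open>[0, x]\<close>.  If \<open>w = p\<close>, the objective of any order is \<open>H (p S)\<close> plus
  the integrals of \<open>h C - h (C - s)\<close> over \<open>0 \<le> s \<le> p j\<close>, where \<open>C\<close> is the completion time of \<open>j\<close>.  The integrand lies
  between \<open>c * h s\<close> and \<open>h s\<close>, so with \<open>D = \<Sum> H (p j) \<le> H (p S)\<close> the objectives of any two orders
  have ratio at most \<open>(H (p S) + D) / (H (p S) + c * D) \<le> 2 / (1 + c)\<close>.  For general weights, \<open>w j / p j\<close> is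
  non-increasing along the Smith order, so by Abel summation it is enough to compare
  orders on each of its prefixes with \<open>w = p\<close>.
\<close>

section \<open>Concave cost functions and curvature\<close>

text \<open>\<open>C\<close> and \<open>P - s\<close> lie symmetrically in the interval from
  \<open>C - s\<close> to \<open>P\<close>: they are convex combinations of its end points with
  swapped coefficients. Adding the two concavity inequalities gives the claim.\<close>

lemma concave_cost_decreasing_increments:
  assumes "concave_cost h" "0 \<le> s" "s \<le> C" "C \<le> P"
  shows "h P - h (P - s) \<le> h C - h (C - s)"
proof (cases "P = C - s")
  case True
  then have "s = 0" "P = C" using assms by auto
  then show ?thesis by simp
next
  case False
  define t where "t = s / (P - (C - s))"
  have t: "0 \<le> t" "t \<le> 1" and L: "t * (P - (C - s)) = s"
    using assms False by (auto simp: t_def field_simps)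
  have conc: "concave_on {0..} h" using assms by (simp add: concave_cost_def)
  have "(1 - t) * (C - s) + t * P = C" "(1 - t) * P + t * (C - s) = P - s"
    using L by (simp_all add: algebra_simps)
  moreover have "(1 - t) * h (C - s) + t * h P \<le> h ((1 - t) * (C - s) + t * P)"
    "(1 - t) * h P + t * h (C - s) \<le> h ((1 - t) * P + t * (C - s))"
    using concave_onD[OF conc t, of "C - s" P] concave_onD[OF conc t, of P "C - s"] assms by auto
  ultimately have "(1 - t) * h (C - s) + t * h P \<le> h C" "(1 - t) * h P + t * h (C - s) \<le> h (P - s)"
    by simp_all
  then show ?thesis by (simp add: algebra_simps)
qed

text \<open>The comparison interval is \<open>[0, s]\<close>, on which the increment is
  \<open>h s\<close> because \<open>h 0 = 0\<close>.\<close>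

lemma concave_cost_subadditive:
  assumes "concave_cost h" "0 \<le> s" "s \<le> C"
  shows "h C - h (C - s) \<le> h s"
  using concave_cost_decreasing_increments[OF assms(1,2) order.refl assms(3)] assms(1)
  by (simp add: concave_cost_def)

lemma concave_cost_mono:
  assumes "concave_cost h" "0 \<le> x" "x \<le> y"
  shows "h x \<le> h y"
  using assms by (auto simp: concave_cost_def intro: mono_onD)

lemma concave_cost_nonneg:
  assumes "concave_cost h" "0 \<le> x"
  shows "0 \<le> h x"
  using concave_cost_mono[OF assms(1) order.refl assms(2)] assms(1) by (simp add: concave_cost_def)

text \<open>Concavity between \<open>0\<close> and \<open>s\<close>: chords starting at the origin
  get steeper as they get shorter.\<close>

lemma concave_cost_scale:
  assumes "concave_cost h" "0 \<le> t" "t \<le> 1" "0 \<le> s"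
  shows "t * h s \<le> h (t * s)"
proof -
  have "concave_on {0..} h" "h 0 = 0" using assms by (simp_all add: concave_cost_def)
  with concave_onD[OF this(1) assms(2,3), of 0 s] assms(4) show ?thesis by simp
qed

text \<open>The counterpart at the right end: chords ending at \<open>P\<close> get flatter as they
  get shorter.\<close>

lemma concave_cost_chord_at_end:
  assumes "concave_cost h" "0 \<le> t" "t \<le> 1" "0 \<le> s" "s \<le> P"
  shows "h P - h (P - t * s) \<le> t * (h P - h (P - s))"
proof -
  have "concave_on {0..} h" using assms by (simp add: concave_cost_def)
  moreover have "(1 - t) * P + t * (P - s) = P - t * s" by (simp add: algebra_simps)
  ultimately have "(1 - t) * h P + t * h (P - s) \<le> h (P - t * s)"
    using concave_onD[OF _ assms(2,3), of "{0..}" h P "P - s"] assms by auto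
  then show ?thesis by (simp add: algebra_simps)
qed

text \<open>
  With \<open>s = P - y\<close>, the quotient compares the slope of the chord of \<open>h\<close> over \<open>[P - s, P]\<close> with that
  over \<open>[0, s]\<close>.  As \<open>s\<close> decreases, the former decreases and the latter increases.
\<close>

lemma curvature_quotient_antimono:
  assumes h: "concave_cost h" and "0 \<le> x" "x \<le> y" "y < P"
  shows "curvature_quotient h P y \<le> curvature_quotient h P x"
proof -
  define t where "t = (P - y) / (P - x)"
  have t: "0 < t" "t \<le> 1" and y: "t * (P - x) = P - y"
    using assms by (auto simp: t_def field_simps)
  have pos: "0 < h (P - x)" using h assms by (simp add: concave_cost_def)
  have nonneg: "0 \<le> h P - h x" using concave_cost_mono[OF h] assms by simp
  have "h P - h y \<le> t * (h P - h x)"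
    using concave_cost_chord_at_end[OF h, of t "P - x" P] t y assms by simp
  moreover have "t * h (P - x) \<le> h (P - y)"
    using concave_cost_scale[OF h, of t "P - x"] t y assms by simp
  ultimately have "(h P - h y) / h (P - y) \<le> (t * (h P - h x)) / (t * h (P - x))"
    using t pos nonneg by (intro frac_le) auto
  also have "\<dots> = (h P - h x) / h (P - x)" using t by simp
  finally show ?thesis by (simp add: curvature_quotient_def)
qed

lemma curvature_quotient_nonneg:
  assumes "concave_cost h" "0 \<le> y" "y \<le> P"
  shows "0 \<le> curvature_quotient h P y"
  using concave_cost_mono[OF assms] concave_cost_nonneg[OF assms(1), of "P - y"] assms(3)
  by (simp add: curvature_quotient_def)

text \<open>Below the infimum nothing is attained, and a single point \<open>x\<close> with
  \<open>f x < u\<close> keeps \<open>f\<close> below \<open>u\<close> on the whole rest of the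
  interval.\<close>

lemma tendsto_INF_at_left:
  fixes f :: "real \<Rightarrow> real"
  assumes anti: "\<And>x y. a \<le> x \<Longrightarrow> x \<le> y \<Longrightarrow> y < b \<Longrightarrow> f y \<le> f x"
    and bdd: "bdd_below (f ` {a..<b})" and "a < b"
  shows "(f \<longlongrightarrow> (INF x\<in>{a..<b}. f x)) (at_left b)"
proof (rule order_tendstoI)
  fix l assume l: "l < (INF x\<in>{a..<b}. f x)"
  have "eventually (\<lambda>x. x \<in> {a<..<b}) (at_left b)"
    by (rule eventually_at_leftI[OF _ \<open>a < b\<close>]) auto
  then show "eventually (\<lambda>x. l < f x) (at_left b)"
  proof eventually_elim
    case (elim x)
    then have "(INF x\<in>{a..<b}. f x) \<le> f x" by (intro cINF_lower bdd) auto
    with l show ?case by simp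
  qed
next
  fix u assume "(INF x\<in>{a..<b}. f x) < u"
  then obtain x where x: "x \<in> {a..<b}" "f x < u"
    using bdd \<open>a < b\<close> by (subst (asm) cINF_less_iff) auto
  show "eventually (\<lambda>y. f y < u) (at_left b)"
  proof (rule eventually_at_leftI)
    show "x < b" using x by simp
    show "f y < u" if "y \<in> {x<..<b}" for y
      using anti[of x y] that x by auto
  qed
qed

text \<open>By monotonicity the limit is an infimum. Hence it exists and bounds the quotient at
  every point, which turns a limit at \<open>P\<close> into an inequality for all interval
  lengths.\<close>

lemma curvature_quotient_tendsto:
  assumes h: "concave_cost h" and "0 < P"
  shows "(curvature_quotient h P \<longlongrightarrow> 1 - curvature h P) (at_left P)"
    and "0 \<le> y \<Longrightarrow> y < P \<Longrightarrow> 1 - curvature h P \<le> curvature_quotient h P y"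
    and "0 \<le> 1 - curvature h P"
proof -
  let ?q = "curvature_quotient h P"
  have bdd: "bdd_below (?q ` {0..<P})"
    by (rule bdd_belowI[of _ 0]) (auto intro: curvature_quotient_nonneg[OF h])
  have lim: "(?q \<longlongrightarrow> (INF y\<in>{0..<P}. ?q y)) (at_left P)"
    by (rule tendsto_INF_at_left[OF _ bdd \<open>0 < P\<close>]) (rule curvature_quotient_antimono[OF h])
  \<comment> \<open>\<open>Lim\<close> is determined only now that convergence has been
    established.\<close>
  moreover have eq: "1 - curvature h P = (INF y\<in>{0..<P}. ?q y)"
    using tendsto_Lim[OF _ lim] by (simp add: curvature_def)
  ultimately show "(?q \<longlongrightarrow> 1 - curvature h P) (at_left P)" by simp
  show "1 - curvature h P \<le> ?q y" if "0 \<le> y" "y < P" for y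
    unfolding eq using that by (intro cINF_lower bdd) auto
  show "0 \<le> 1 - curvature h P"
    unfolding eq using \<open>0 < P\<close> by (intro cINF_greatest) (auto intro: curvature_quotient_nonneg[OF h])
qed

lemma curvature_le_1:
  assumes h: "concave_cost h" and "0 < P"
  shows "1 - curvature h P \<le> 1"
proof -
  have "h P > 0" "h 0 = 0" using h \<open>0 < P\<close> by (auto simp: concave_cost_def)
  then have "curvature_quotient h P 0 = 1" by (simp add: curvature_quotient_def)
  with curvature_quotient_tendsto(2)[OF assms, of 0] \<open>0 < P\<close> show ?thesis by simp
qed

text \<open>The quotient at \<open>y = P - s\<close> gives the bound for the last interval of length
  \<open>s\<close> before \<open>P\<close>; increments over earlier intervals of this length are at
  least as large.\<close>

lemma concave_cost_increment_ge:
  assumes h: "concave_cost h" and "0 < P" "0 \<le> s" "s \<le> C" "C \<le> P"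
  shows "(1 - curvature h P) * h s \<le> h C - h (C - s)"
proof (cases "s = 0")
  case True
  then show ?thesis using h by (simp add: concave_cost_def)
next
  case False
  then have "0 < h s" using h assms by (simp add: concave_cost_def)
  then have "(1 - curvature h P) * h s \<le> h P - h (P - s)"
    using curvature_quotient_tendsto(2)[OF h \<open>0 < P\<close>, of "P - s"] assms False
    by (simp add: curvature_quotient_def field_simps)
  also have "\<dots> \<le> h C - h (C - s)"
    using concave_cost_decreasing_increments[OF h] assms by simp
  finally show ?thesis .
qed

text \<open>Dividing numerator and denominator of the quotient by \<open>P - y\<close> leaves
  difference quotients of \<open>h\<close> at \<open>P\<close> and at \<open>0\<close>.\<close>

lemma curvature_eq_derivative_ratio:
  assumes h: "concave_cost h" and P: "0 < P"
    and d0: "(h has_real_derivative d0) (at_right 0)" and dP: "(h has_real_derivative dP) (at P)"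
  shows "1 - curvature h P = dP / d0"
proof -
  have h0: "h 0 = 0" using h by (simp add: concave_cost_def)
  have slope0: "((\<lambda>s. h s / s) \<longlongrightarrow> d0) (at_right 0)"
    using d0 h0 by (simp add: has_field_derivative_iff)
  \<comment> \<open>Slopes of chords from the origin are at least \<open>h P / P > 0\<close>, so the
    denominator \<open>d0\<close> of the limit is nonzero.\<close>
  have "h P / P \<le> d0"
  proof (rule tendsto_lowerbound[OF slope0])
    have "eventually (\<lambda>s. s \<in> {0<..<P}) (at_right 0)"
      by (rule eventually_at_rightI[OF _ P]) auto
    then show "eventually (\<lambda>s. h P / P \<le> h s / s) (at_right 0)"
    proof eventually_elim
      case (elim s)
      with concave_cost_scale[OF h, of "s / P" P] P show ?case by (simp add: field_simps)
    qed
  qed simp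
  moreover have "0 < h P / P" using h P by (simp add: concave_cost_def)
  ultimately have "d0 \<noteq> 0" by simp
  have "LIM y at_left P. P - y :> at_right 0"
    by (auto simp: filterlim_at eventually_at_filter intro!: tendsto_eq_intros)
  then have lim0: "((\<lambda>y. h (P - y) / (P - y)) \<longlongrightarrow> d0) (at_left P)"
    by (rule filterlim_compose[OF slope0])
  have "((\<lambda>y. (h y - h P) / (y - P)) \<longlongrightarrow> dP) (at_left P)"
    using dP by (auto simp: has_field_derivative_iff intro: tendsto_mono at_le)
  from tendsto_divide[OF this lim0 \<open>d0 \<noteq> 0\<close>]
  have "(curvature_quotient h P \<longlongrightarrow> dP / d0) (at_left P)"
  proof (rule Lim_transform_eventually)
    have "eventually (\<lambda>y. y \<in> {0<..<P}) (at_left P)"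
      by (rule eventually_at_leftI[OF _ P]) auto
    then show "eventually (\<lambda>y. (h y - h P) / (y - P) / (h (P - y) / (P - y)) =
      curvature_quotient h P y) (at_left P)"
    proof eventually_elim
      case (elim y)
      then have "h (P - y) > 0" using h by (simp add: concave_cost_def)
      with elim show ?case by (simp add: curvature_quotient_def field_simps)
    qed
  qed
  with curvature_quotient_tendsto(1)[OF h P] show ?thesis
    by (rule tendsto_unique[rotated]) simp
qed

section \<open>The approximation ratio of Smith's rule\<close>

lemma integral_reflect_real_interval:
  fixes f :: "real \<Rightarrow> real"
  assumes "(f has_integral I) {a..b}"
  shows "((\<lambda>s. f (b - s)) has_integral I) {0..b - a}"
proof -
  have "((\<lambda>t. f (- t)) has_integral I) {- b..- a}" using assms by simp
  then have "((\<lambda>t. f (- t)) has_integral I) {0 + - b..(b - a) + - b}" by simp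
  then have "((\<lambda>t. f (- t)) \<circ> (+) (- b) has_integral I) {0..b - a}"
    by (subst has_integral_shift_Icc_real)
  then show ?thesis by (simp add: o_def)
qed

definition primitive :: "(real \<Rightarrow> real) \<Rightarrow> real \<Rightarrow> real" where
  "primitive h x = integral {0..x} h"

lemma concave_cost_integrable:
  assumes "concave_cost h" "0 \<le> a"
  shows "h integrable_on {a..b}"
  using assms by (intro integrable_on_mono_on) (auto simp: concave_cost_def mono_on_def)

text \<open>The integral over \<open>[q, q + x]\<close> is read backwards, so that \<open>s\<close>
  is the distance to the completion time \<open>q + x\<close>, as in the increment bounds.\<close>

lemma primitive_increment:
  assumes h: "concave_cost h" and "0 \<le> q" "0 \<le> x"
  shows "((\<lambda>s. h (q + x - s)) has_integral primitive h (q + x) - primitive h q) {0..x}"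
proof -
  have "integral {0..q} h + integral {q..q + x} h = integral {0..q + x} h"
    using assms by (intro Henstock_Kurzweil_Integration.integral_combine concave_cost_integrable) auto
  moreover have "(h has_integral integral {q..q + x} h) {q..q + x}"
    using assms by (intro integrable_integral concave_cost_integrable)
  ultimately have "(h has_integral primitive h (q + x) - primitive h q) {q..q + x}"
    by (metis primitive_def add_diff_cancel_left')
  from integral_reflect_real_interval[OF this] show ?thesis by simp
qed

lemma primitive_has_integral:
  assumes "concave_cost h"
  shows "(h has_integral primitive h x) {0..x}"
  unfolding primitive_def by (intro integrable_integral concave_cost_integrable assms order.refl)

lemma primitive_superadditive:
  assumes h: "concave_cost h" and "0 \<le> q" "0 \<le> x"
  shows "primitive h q + primitive h x \<le> primitive h (q + x)"
proof -
  have "((\<lambda>s. h (x - s)) has_integral primitive h x) {0..x}"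
    using primitive_increment[OF h order.refl, of x] assms by (simp add: primitive_def)
  then have "primitive h x \<le> primitive h (q + x) - primitive h q"
    using primitive_increment[OF assms]
    by (rule has_integral_le) (use assms in \<open>auto intro: concave_cost_mono\<close>)
  then show ?thesis by simp
qed

text \<open>For a job with start \<open>q\<close> and with length and weight \<open>x\<close>, this
  is the excess of its cost over the area under \<open>h\<close> during its processing.\<close>

lemma has_integral_const_diff_concave:
  assumes "concave_cost h" "0 \<le> q" "0 \<le> x"
  shows "((\<lambda>s. h (q + x) - h (q + x - s)) has_integral
           x * h (q + x) - (primitive h (q + x) - primitive h q)) {0..x}"
  using has_integral_diff[OF has_integral_const_real[of "h (q + x)" 0 x] primitive_increment[OF assms]]
    assms(3) by simp

text \<open>Subadditivity bounds the integrand of the excess by \<open>h s\<close>.\<close>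

lemma job_cost_le:
  assumes h: "concave_cost h" and "0 \<le> q" "0 \<le> x"
  shows "x * h (q + x) \<le> primitive h (q + x) - primitive h q + primitive h x"
proof -
  have "x * h (q + x) - (primitive h (q + x) - primitive h q) \<le> primitive h x"
    using has_integral_const_diff_concave[OF assms] primitive_has_integral[OF h]
    by (rule has_integral_le) (use assms in \<open>auto intro!: concave_cost_subadditive\<close>)
  then show ?thesis by simp
qed

text \<open>The curvature bounds the integrand of the excess from below by
  \<open>(1 - curvature h P) * h s\<close>.\<close>

lemma job_cost_ge:
  assumes h: "concave_cost h" and "0 < P" "0 \<le> q" "0 \<le> x" "q + x \<le> P"
  shows "primitive h (q + x) - primitive h q + (1 - curvature h P) * primitive h x \<le> x * h (q + x)"
proof -
  have "((\<lambda>s. (1 - curvature h P) * h s) has_integral (1 - curvature h P) * primitive h x) {0..x}"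
    by (intro has_integral_mult_right primitive_has_integral h)
  then have "(1 - curvature h P) * primitive h x \<le> x * h (q + x) - (primitive h (q + x) - primitive h q)"
    using has_integral_const_diff_concave[OF h \<open>0 \<le> q\<close> \<open>0 \<le> x\<close>]
    by (rule has_integral_le) (use assms in \<open>auto intro!: concave_cost_increment_ge\<close>)
  then show ?thesis by simp
qed

section \<open>Completion times, and jobs whose weight is their processing time\<close>

lemma completion_time_snoc:
  assumes "distinct (xs @ [x])"
  shows "completion_time p (xs @ [x]) x = sum p (set xs) + p x"
proof -
  have "takeWhile (\<lambda>k. k \<noteq> x) (xs @ [x]) = xs"
    using assms by (subst takeWhile_append2) auto
  then show ?thesis
    using assms by (simp add: completion_time_def sum_list_distinct_conv_sum_set)
qed

lemma completion_time_append:
  assumes "j \<in> set xs"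
  shows "completion_time p (xs @ ys) j = completion_time p xs j"
  using assms by (simp add: completion_time_def takeWhile_append1)

lemma completion_time_nonneg:
  assumes "\<And>k. k \<in> set xs \<Longrightarrow> 0 \<le> p k" "j \<in> set xs"
  shows "0 \<le> completion_time p xs j"
  unfolding completion_time_def using assms
  by (intro add_nonneg_nonneg sum_list_nonneg) (auto dest: set_takeWhileD)

text \<open>A job appended at the end leaves the earlier completion times unchanged, and the
  differences of \<open>primitive h\<close> telescope.\<close>

lemma uniform_objective_le:
  assumes h: "concave_cost h" and "distinct xs" "\<And>j. j \<in> set xs \<Longrightarrow> 0 \<le> p j"
  shows "(\<Sum>j\<in>set xs. p j * h (completion_time p xs j)) \<le>
    primitive h (sum p (set xs)) + (\<Sum>j\<in>set xs. primitive h (p j))"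
  using assms(2,3)
proof (induction xs rule: rev_induct)
  case Nil
  then show ?case by (simp add: primitive_def)
next
  case (snoc x xs)
  have "p x * h (sum p (set xs) + p x) \<le>
      primitive h (sum p (set xs) + p x) - primitive h (sum p (set xs)) + primitive h (p x)"
    using snoc.prems by (intro job_cost_le h sum_nonneg) auto
  moreover have "(\<Sum>j\<in>set xs. p j * h (completion_time p (xs @ [x]) j)) =
      (\<Sum>j\<in>set xs. p j * h (completion_time p xs j))"
    by (intro sum.cong) (simp_all add: completion_time_append)
  ultimately show ?case
    using snoc completion_time_snoc[OF snoc.prems(1), of p] by (simp add: add.commute)
qed

text \<open>Only the jobs in \<open>A\<close>, a prefix of the Smith order, carry weight; the others merely delay them.\<close>

lemma uniform_objective_ge:
  assumes h: "concave_cost h" and P: "0 < P" and "distinct xs" "\<And>j. j \<in> set xs \<Longrightarrow> 0 \<le> p j"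
    and "sum p (set xs) \<le> P"
  shows "primitive h (sum p (set xs \<inter> A)) + (1 - curvature h P) * (\<Sum>j\<in>set xs \<inter> A. primitive h (p j)) \<le>
    (\<Sum>j\<in>set xs \<inter> A. p j * h (completion_time p xs j))"
  using assms(3-)
proof (induction xs rule: rev_induct)
  case Nil
  then show ?case by (simp add: primitive_def)
next
  case (snoc x xs)
  have le: "sum p (set xs) + p x \<le> P" and px: "0 \<le> p x" using snoc.prems by (auto simp: add.commute)
  then have "sum p (set xs) \<le> P" by simp
  then have IH: "primitive h (sum p (set xs \<inter> A)) + (1 - curvature h P) * (\<Sum>j\<in>set xs \<inter> A. primitive h (p j)) \<le>
    (\<Sum>j\<in>set xs \<inter> A. p j * h (completion_time p xs j))"
    using snoc by simp
  have eq: "(\<Sum>j\<in>set xs \<inter> A. p j * h (completion_time p (xs @ [x]) j)) =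
      (\<Sum>j\<in>set xs \<inter> A. p j * h (completion_time p xs j))"
    by (intro sum.cong) (simp_all add: completion_time_append)
  show ?case
  proof (cases "x \<in> A")
    case False
    then show ?thesis using IH eq by simp
  next
    case True
    let ?q = "sum p (set xs \<inter> A)"
    have q: "0 \<le> ?q" "?q \<le> sum p (set xs)"
      using snoc.prems by (auto intro!: sum_nonneg sum_mono2)
    have "primitive h (?q + p x) - primitive h ?q + (1 - curvature h P) * primitive h (p x)
        \<le> p x * h (?q + p x)"
      using q px le by (intro job_cost_ge h P) auto
    \<comment> \<open>\<open>?q\<close> counts only the predecessors in \<open>A\<close>; all
      predecessors together delay \<open>x\<close> at least as much.\<close>
    also have "\<dots> \<le> p x * h (completion_time p (xs @ [x]) x)"
      using q px completion_time_snoc[OF snoc.prems(1), of p]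
      by (auto intro!: mult_left_mono concave_cost_mono[OF h])
    finally show ?thesis
      using True IH eq snoc.prems by (simp add: algebra_simps)
  qed
qed

lemma sum_primitive_le:
  assumes h: "concave_cost h" and "finite A" "\<And>j. j \<in> A \<Longrightarrow> 0 \<le> p j"
  shows "(\<Sum>j\<in>A. primitive h (p j)) \<le> primitive h (sum p A)"
  using assms(2,3)
proof (induction rule: finite_induct)
  case empty
  then show ?case by (simp add: primitive_def)
next
  case (insert x A)
  have "primitive h (p x) + primitive h (sum p A) \<le> primitive h (p x + sum p A)"
    using insert.prems by (intro primitive_superadditive h sum_nonneg) auto
  with insert show ?case by simp
qed

text \<open>The upper bound for \<open>xs\<close> and the lower bound for \<open>ys\<close> involve
  the same two quantities \<open>?I\<close> and \<open>?D\<close>, which depend only on the set of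
  weighted jobs and not on the order.\<close>

lemma uniform_objective_ratio:
  assumes h: "concave_cost h" and P: "0 < P"
    and xs: "distinct xs" and ys: "distinct ys" and sub: "set xs \<subseteq> set ys"
    and p: "\<And>j. j \<in> set ys \<Longrightarrow> 0 \<le> p j" and le: "sum p (set ys) \<le> P"
  shows "(\<Sum>j\<in>set xs. p j * h (completion_time p xs j)) \<le>
    2 / (2 - curvature h P) * (\<Sum>j\<in>set xs. p j * h (completion_time p ys j))"
proof -
  let ?c = "1 - curvature h P" and ?D = "\<Sum>j\<in>set xs. primitive h (p j)"
  let ?I = "primitive h (sum p (set xs))"
  have c: "0 \<le> ?c" "?c \<le> 1"
    using curvature_quotient_tendsto(3)[OF h P] curvature_le_1[OF h P] by auto
  have "set ys \<inter> set xs = set xs" using sub by auto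
  then have lower: "?I + ?c * ?D \<le> (\<Sum>j\<in>set xs. p j * h (completion_time p ys j))"
    using uniform_objective_ge[OF h P ys p le, of "set xs"] by simp
  have "?D \<le> ?I" using sub p by (intro sum_primitive_le h) auto
  \<comment> \<open>The two sides of the next inequality differ by exactly
    \<open>(1 - ?c) * (?I - ?D)\<close>, and \<open>1 + ?c\<close> is
    \<open>2 - curvature h P\<close>.\<close>
  then have "(1 - ?c) * ?D \<le> (1 - ?c) * ?I" using c by (intro mult_left_mono) auto
  then have "(1 + ?c) * (?I + ?D) \<le> 2 * (?I + ?c * ?D)" by (simp add: algebra_simps)
  then have "?I + ?D \<le> 2 / (1 + ?c) * (?I + ?c * ?D)" using c by (simp add: field_simps)
  also have "\<dots> \<le> 2 / (1 + ?c) * (\<Sum>j\<in>set xs. p j * h (completion_time p ys j))"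
    using c lower by (intro mult_left_mono) auto
  finally show ?thesis
    using uniform_objective_le[OF h xs, of p] sub p by force
qed

section \<open>Passage to general weights by Abel summation\<close>

lemma abel_sum_nonneg:
  fixes u d :: "'b \<Rightarrow> real"
  assumes "sorted_wrt (\<lambda>i j. u j \<le> u i) xs" "\<And>j. j \<in> set xs \<Longrightarrow> 0 \<le> u j"
    and "\<And>k. k \<le> length xs \<Longrightarrow> 0 \<le> (\<Sum>j\<leftarrow>take k xs. d j)"
  shows "0 \<le> (\<Sum>j\<leftarrow>xs. u j * d j)"
proof -
  \<comment> \<open>Strengthened to any nonnegative lower bound \<open>v\<close> of the weights: the
    induction hypothesis is applied with the last, smallest weight \<open>u x\<close>. The claim is
    the case \<open>v = 0\<close>.\<close>
  have "v * (\<Sum>j\<leftarrow>xs. d j) \<le> (\<Sum>j\<leftarrow>xs. u j * d j)"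
    if "0 \<le> v" "\<And>j. j \<in> set xs \<Longrightarrow> v \<le> u j" for v
    using assms that
  proof (induction xs arbitrary: v rule: rev_induct)
    case Nil
    then show ?case by simp
  next
    case (snoc x xs)
    have prefix: "0 \<le> (\<Sum>j\<leftarrow>take k xs. d j)" if "k \<le> length xs" for k
      using snoc.prems(3)[of k] that by simp
    have "u x * (\<Sum>j\<leftarrow>xs. d j) \<le> (\<Sum>j\<leftarrow>xs. u j * d j)"
      using snoc.prems by (intro snoc.IH prefix) (auto simp: sorted_wrt_append)
    then have "u x * (\<Sum>j\<leftarrow>xs @ [x]. d j) \<le> (\<Sum>j\<leftarrow>xs @ [x]. u j * d j)"
      by (simp add: algebra_simps)
    moreover have "v * (\<Sum>j\<leftarrow>xs @ [x]. d j) \<le> u x * (\<Sum>j\<leftarrow>xs @ [x]. d j)"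
      using snoc.prems(3)[of "length (xs @ [x])"] snoc.prems(5)[of x] by (intro mult_right_mono) simp_all
    ultimately show ?case by linarith
  qed
  from this[of 0] assms(2) show ?thesis by simp
qed

text \<open>
  Sorting by this key is Smith's rule of non-increasing \<open>w j / p j\<close>.  Jobs with \<open>p j = 0\<close> come
  first, including those with \<open>p j = w j = 0\<close>, for which the quotient is \<open>0 / 0 = 0\<close>.
\<close>

definition smith_key :: "('a \<Rightarrow> real) \<Rightarrow> ('a \<Rightarrow> real) \<Rightarrow> 'a \<Rightarrow> real" where
  "smith_key p w j = p j / (p j + w j)"

text \<open>With \<open>u j\<close> in the role of \<open>w j / p j\<close>, it remains to show that
  the sum of \<open>u j * d j\<close> is nonnegative. Along the Smith order \<open>u\<close> is
  non-increasing, and the prefix sums of \<open>d\<close> are nonnegative by the case of weights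
  \<open>p\<close>.\<close>

lemma smith_objective_ratio:
  assumes jobs: "valid_jobs S p w" and h: "concave_cost h"
    and xs: "xs \<in> permutations_of_set S" and ys: "ys \<in> permutations_of_set S"
    and sorted: "sorted_wrt (\<lambda>i j. smith_key p w i \<le> smith_key p w j) xs"
  shows "objective S p w h xs \<le> 2 / (2 - curvature h (sum p S)) * objective S p w h ys"
proof -
  define P where "P = sum p S"
  define \<alpha> where "\<alpha> = 2 / (2 - curvature h P)"
  \<comment> \<open>\<open>M\<close> is at least every ratio \<open>w j / p j\<close>. It replaces
    the default value \<open>0\<close> of this ratio for jobs of length \<open>0\<close>, which come
    first, so that \<open>u\<close> stays non-increasing.\<close>
  define M where "M = (\<Sum>i\<in>S. w i / p i)"
  define u where "u j = (if p j = 0 then M else w j / p j)" for j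
  define d where "d j = \<alpha> * (p j * h (completion_time p ys j)) - p j * h (completion_time p xs j)" for j
  have S: "finite S" "set xs = S" "distinct xs" "set ys = S" "distinct ys"
    and p: "\<And>j. j \<in> S \<Longrightarrow> 0 \<le> p j" and w: "\<And>j. j \<in> S \<Longrightarrow> 0 \<le> w j" and P: "0 < P"
    using jobs xs ys by (auto simp: valid_jobs_def permutations_of_set_def P_def)
  have \<alpha>: "0 \<le> \<alpha>" using curvature_quotient_tendsto(3)[OF h P] by (simp add: \<alpha>_def)
  have M: "0 \<le> M" unfolding M_def using p w by (intro sum_nonneg) auto
  have le_M: "w j / p j \<le> M" if "j \<in> S" for j
    unfolding M_def using S(1) p w that by (intro member_le_sum) auto
  have u_nonneg: "0 \<le> u j" if "j \<in> S" for j
    using that p w M by (auto simp: u_def)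
  have u_mono: "u j \<le> u i" if "i \<in> S" "j \<in> S" "smith_key p w i \<le> smith_key p w j" for i j
  proof (cases "p i = 0")
    case True
    then show ?thesis using le_M that by (simp add: u_def)
  next
    case False
    then have pi: "0 < p i" using p[of i] that by auto
    with w[of i] that have "0 < smith_key p w i" by (simp add: smith_key_def)
    with that have "0 < smith_key p w j" by simp
    then have pj: "0 < p j" using p[of j] that by (cases "p j = 0") (auto simp: smith_key_def)
    have "p i * (p j + w j) \<le> p j * (p i + w i)"
      using that pi pj w[of i] w[of j] by (simp add: smith_key_def divide_le_eq le_divide_eq field_simps)
    with pi pj show ?thesis by (simp add: u_def field_simps)
  qed
  have "0 \<le> (\<Sum>j\<leftarrow>xs. u j * d j)"
  proof (rule abel_sum_nonneg)
    show "sorted_wrt (\<lambda>i j. u j \<le> u i) xs"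
      by (rule sorted_wrt_mono_rel[OF _ sorted]) (use u_mono S in auto)
    show "0 \<le> u j" if "j \<in> set xs" for j using that u_nonneg S by simp
    fix k assume "k \<le> length xs"
    let ?zs = "take k xs"
    \<comment> \<open>The prefix run on its own is compared with the same jobs inside the whole
      order \<open>ys\<close>.\<close>
    have "(\<Sum>j\<in>set ?zs. p j * h (completion_time p ?zs j)) \<le>
      \<alpha> * (\<Sum>j\<in>set ?zs. p j * h (completion_time p ys j))"
      unfolding \<alpha>_def using S p
      by (intro uniform_objective_ratio h P) (auto dest: in_set_takeD simp: P_def)
    moreover have "completion_time p ?zs j = completion_time p xs j" if "j \<in> set ?zs" for j
      using completion_time_append[OF that, of p "drop k xs"] by simp
    ultimately have "0 \<le> (\<Sum>j\<in>set ?zs. d j)"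
      by (simp add: d_def sum_subtractf sum_distrib_left)
    then show "0 \<le> (\<Sum>j\<leftarrow>?zs. d j)" using S by (simp add: sum_list_distinct_conv_sum_set)
  qed
  then have "(\<Sum>j\<in>S. u j * (p j * h (completion_time p xs j))) \<le>
      \<alpha> * (\<Sum>j\<in>S. u j * (p j * h (completion_time p ys j)))"
    using S by (simp add: sum_list_distinct_conv_sum_set d_def algebra_simps sum_subtractf sum_distrib_left)
  \<comment> \<open>\<open>u j * p j\<close> is \<open>w j\<close>, except that it is
    \<open>0\<close> for jobs of length \<open>0\<close>. Dropping their cost only decreases the
    objective of \<open>ys\<close>.\<close>
  also have "(\<Sum>j\<in>S. u j * (p j * h (completion_time p ys j))) \<le> objective S p w h ys"
    unfolding objective_def
  proof (rule sum_mono)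
    fix j assume j: "j \<in> S"
    then have "0 \<le> h (completion_time p ys j)"
      using S p by (intro concave_cost_nonneg[OF h] completion_time_nonneg) auto
    then show "u j * (p j * h (completion_time p ys j)) \<le> w j * h (completion_time p ys j)"
      using j w by (simp add: u_def)
  qed
  \<comment> \<open>In \<open>xs\<close> nothing is lost: jobs of length \<open>0\<close> are
    preceded only by such jobs, complete at time \<open>0\<close> and cost
    \<open>h 0 = 0\<close>.\<close>
  also have "(\<Sum>j\<in>S. u j * (p j * h (completion_time p xs j))) = objective S p w h xs"
    unfolding objective_def
  proof (rule sum.cong)
    fix j assume j: "j \<in> S"
    show "u j * (p j * h (completion_time p xs j)) = w j * h (completion_time p xs j)"
    proof (cases "p j = 0")
      case True
      obtain as bs where split: "xs = as @ j # bs" "j \<notin> set as"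
        using j S split_list_first by metis
      have "p i = 0" if "i \<in> set as" for i
      proof -
        have "i \<in> S" using that split S by auto
        moreover have "smith_key p w i \<le> 0"
          using sorted split that True by (auto simp: sorted_wrt_append smith_key_def)
        ultimately show ?thesis using p[of i] w[of i]
          by (auto simp: smith_key_def divide_le_0_iff)
      qed
      then have "map p as = map (\<lambda>_. 0) as" by simp
      moreover have "takeWhile (\<lambda>k. k \<noteq> j) xs = as"
        unfolding split(1) using split(2) by (subst takeWhile_append2) auto
      ultimately have "completion_time p xs j = 0"
        using True by (simp only: completion_time_def) simp
      then show ?thesis using True h by (simp add: concave_cost_def)
    qed (simp add: u_def)
  qed simp
  finally have "objective S p w h xs \<le> \<alpha> * objective S p w h ys"
    using \<alpha> by (simp add: mult_left_mono)
  then show ?thesis by (simp only: \<alpha>_def P_def)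
qed

lemma smith_order_approx_ratio:
  assumes "valid_jobs S p w" "concave_cost h" "xs \<in> permutations_of_set S"
    and "sorted_wrt (\<lambda>i j. smith_key p w i \<le> smith_key p w j) xs"
  shows "has_approx_ratio (2 / (2 - curvature h (sum p S))) S p w h xs"
proof -
  have "opt S p w h \<in> objective S p w h ` permutations_of_set S"
    unfolding opt_def using assms(1)
    by (intro Min_in) (auto simp: valid_jobs_def permutations_of_set_empty_iff)
  then show ?thesis
    using smith_objective_ratio[OF assms(1-3) _ assms(4)] assms(3)
    by (auto simp: has_approx_ratio_def)
qed

section \<open>Sorting by computing ranks\<close>

text \<open>Ties are broken by index, which makes this a strict total order even if keys
  coincide.\<close>

definition ranks_before :: "(nat \<Rightarrow> real) \<Rightarrow> nat \<Rightarrow> nat \<Rightarrow> bool" where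
  "ranks_before f l i \<longleftrightarrow> f l < f i \<or> (\<not> f i < f l \<and> l < i)"

definition target_pos :: "(nat \<Rightarrow> real) \<Rightarrow> nat \<Rightarrow> nat \<Rightarrow> nat" where
  "target_pos f n i = card {l. l < n \<and> ranks_before f l i}"

text \<open>By transitivity every predecessor of \<open>l\<close> precedes \<open>i\<close>; the
  inclusion is strict because \<open>l\<close> precedes \<open>i\<close> but not itself.\<close>

lemma target_pos_less:
  assumes "l < n" "ranks_before f l i"
  shows "target_pos f n l < target_pos f n i"
  unfolding target_pos_def
proof (intro psubset_card_mono psubsetI)
  show "{k. k < n \<and> ranks_before f k l} \<subseteq> {k. k < n \<and> ranks_before f k i}"
    using assms by (auto simp: ranks_before_def)
  show "{k. k < n \<and> ranks_before f k l} \<noteq> {k. k < n \<and> ranks_before f k i}"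
    using assms by (auto simp: ranks_before_def)
qed simp

text \<open>Totality of the order gives injectivity, and no index precedes itself, so all positions
  are below \<open>n\<close>.\<close>

lemma target_pos_bij: "bij_betw (target_pos f n) {..<n} {..<n}"
proof -
  have "inj_on (target_pos f n) {..<n}"
  proof (rule inj_onI)
    fix l i assume li: "l \<in> {..<n}" "i \<in> {..<n}" "target_pos f n l = target_pos f n i"
    show "l = i"
    proof (rule ccontr)
      assume "l \<noteq> i"
      then have "ranks_before f l i \<or> ranks_before f i l" by (auto simp: ranks_before_def)
      with li target_pos_less[of l n f i] target_pos_less[of i n f l] show False by auto
    qed
  qed
  moreover have "target_pos f n ` {..<n} \<subseteq> {..<n}"
  proof safe
    fix i assume "i < n"
    then have "{l. l < n \<and> ranks_before f l i} \<subset> {..<n}" by (auto simp: ranks_before_def)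
    then have "target_pos f n i < card {..<n}" unfolding target_pos_def by (intro psubset_card_mono) auto
    then show "target_pos f n i < n" by simp
  qed
  ultimately show ?thesis by (simp add: bij_betw_def endo_inj_surj)
qed

lemma le_of_target_pos_less:
  assumes "i < n" "j < n" "target_pos f n i < target_pos f n j"
  shows "f i \<le> f j"
proof (rule ccontr)
  assume "\<not> f i \<le> f j"
  then have "ranks_before f j i" by (simp add: ranks_before_def)
  with target_pos_less[of j n f i] assms show False by simp
qed

section \<open>Execution and running time of the sorting program\<close>

lemma exec_counting_loop:
  assumes body: "\<And>k s. k < n \<Longrightarrow> I k s \<Longrightarrow> \<exists>t s'. exec h c s t s' \<and> t \<le> T \<and> I (Suc k) s'"
    and guard: "\<And>k s. k \<le> n \<Longrightarrow> I k s \<Longrightarrow> bval b s \<longleftrightarrow> k < n"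
    and "I 0 s"
  shows "\<exists>t s'. exec h (While b c) s t s' \<and> t \<le> n * (1 + btime b + T) + (1 + btime b) \<and> I n s'"
proof -
  \<comment> \<open>Induction on the number \<open>m\<close> of remaining rounds; the last summand
    of the bound pays for the final, failing test.\<close>
  have "\<exists>t s'. exec h (While b c) s t s' \<and> t \<le> m * (1 + btime b + T) + (1 + btime b) \<and> I n s'"
    if "k + m = n" "I k s" for k m s
    using that
  proof (induction m arbitrary: k s)
    case 0
    then have "exec h (While b c) s (1 + btime b) s" using guard[of k s] by (intro WhileFalse) simp
    with 0 show ?case by auto
  next
    case (Suc m)
    then obtain t1 s1 where 1: "exec h c s t1 s1" "t1 \<le> T" "I (Suc k) s1"
      using body[of k s] by auto
    with Suc.IH[of "Suc k" s1] Suc.prems obtain t2 s2 where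
      2: "exec h (While b c) s1 t2 s2" "t2 \<le> m * (1 + btime b + T) + (1 + btime b)" "I n s2"
      by auto
    have "exec h (While b c) s (1 + btime b + t1 + t2) s2"
      using 1 2 Suc.prems guard[of k s] by (intro WhileTrue) auto
    with 1 2 show ?case by (intro exI[of _ "1 + btime b + t1 + t2"] exI[of _ s2]) simp
  qed
  from this[of 0 n s] assms(3) show ?thesis by simp
qed

abbreviation icell :: "name \<Rightarrow> iexp" where "icell x \<equiv> IGet x (IConst 0)"

definition key_exp :: "iexp \<Rightarrow> rexp" where
  "key_exp e = RDivide (RGet ''p'' e) (RPlus (RGet ''p'' e) (RGet ''w'' e))"

text \<open>The disjunction in \<open>ranks_before\<close>, by De Morgan, since \<open>bexp\<close>
  offers only negation and conjunction.\<close>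

definition before_exp :: bexp where
  "before_exp =
     BNot (BAnd (BNot (RLess (key_exp (icell ''j'')) (key_exp (icell ''i''))))
       (BNot (BAnd (BNot (RLess (key_exp (icell ''i'')) (key_exp (icell ''j''))))
         (ILess (icell ''j'') (icell ''i'')))))"

definition rank_step :: com where
  "rank_step = Seq
     (Cond before_exp (IAssign ''r'' (IConst 0) (IPlus (icell ''r'') (IConst 1))) Skip)
     (IAssign ''j'' (IConst 0) (IPlus (icell ''j'') (IConst 1)))"

definition rank_loop :: com where
  "rank_loop = While (ILess (icell ''j'') (icell ''n'')) rank_step"

definition place_step :: com where
  "place_step =
     Seq (IAssign ''r'' (IConst 0) (IConst 0))
    (Seq (IAssign ''j'' (IConst 0) (IConst 0))
    (Seq rank_loop
    (Seq (IAssign ''out'' (icell ''r'') (icell ''i''))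
         (IAssign ''i'' (IConst 0) (IPlus (icell ''i'') (IConst 1))))))"

text \<open>The counter \<open>i\<close> starts at \<open>0\<close> because the input state does;
  \<open>r\<close> and \<open>j\<close> are reset for every job.\<close>

definition rank_sort :: com where
  "rank_sort = While (ILess (icell ''i'') (icell ''n'')) place_step"

definition state_key :: "state \<Rightarrow> nat \<Rightarrow> real" where
  "state_key s l = rvar s ''p'' l / (rvar s ''p'' l + rvar s ''w'' l)"

lemma rval_key_exp: "rval (key_exp e) s = state_key s (ival e s)"
  by (simp add: key_exp_def state_key_def)

lemma bval_before_exp:
  "bval before_exp s \<longleftrightarrow> ranks_before (state_key s) (ivar s ''j'' 0) (ivar s ''i'' 0)"
  by (auto simp: before_exp_def rval_key_exp ranks_before_def)

lemma exec_IAssignI: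
  "T = 1 + itime i + itime e \<Longrightarrow> s' = set_ivar x (ival i s) (ival e s) s \<Longrightarrow> exec h (IAssign x i e) s T s'"
  by (simp only: IAssign)

lemma rank_step_exec:
  "\<exists>t \<le> 70. exec h rank_step s t
    (set_ivar ''j'' 0 (ivar s ''j'' 0 + 1)
      (if ranks_before (state_key s) (ivar s ''j'' 0) (ivar s ''i'' 0)
       then set_ivar ''r'' 0 (ivar s ''r'' 0 + 1) s else s))"
proof -
  have time: "btime before_exp = 57" by (simp add: before_exp_def key_exp_def)
  let ?incr = "IAssign ''r'' (IConst 0) (IPlus (icell ''r'') (IConst 1))"
  let ?c = "Cond before_exp ?incr Skip"
  let ?s = "if ranks_before (state_key s) (ivar s ''j'' 0) (ivar s ''i'' 0)
       then set_ivar ''r'' 0 (ivar s ''r'' 0 + 1) s else s"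
  \<comment> \<open>Branching and test take \<open>1 + 57\<close>, the increment of \<open>r\<close>
    takes \<open>6\<close>.\<close>
  have "\<exists>t \<le> 64. exec h ?c s t ?s"
  proof (cases "bval before_exp s")
    case True
    from CondTrue[OF True IAssign[of h "''r''" "IConst 0" "IPlus (icell ''r'') (IConst 1)"]] show ?thesis
      using True by (intro exI[of _ 64]) (simp add: bval_before_exp time)
  next
    case False
    from CondFalse[OF False Skip] show ?thesis
      using False by (intro exI[of _ 59]) (simp add: bval_before_exp time)
  qed
  then obtain t where t: "t \<le> 64" "exec h ?c s t ?s" by blast
  have "exec h (IAssign ''j'' (IConst 0) (IPlus (icell ''j'') (IConst 1))) ?s 6
      (set_ivar ''j'' 0 (ivar ?s ''j'' 0 + 1) ?s)"
    by (rule exec_IAssignI) simp_all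
  from Seq[OF t(2) this] have "exec h rank_step s (t + 6)
      (set_ivar ''j'' 0 (ivar ?s ''j'' 0 + 1) ?s)"
    by (simp only: rank_step_def)
  moreover have "ivar ?s ''j'' 0 = ivar s ''j'' 0" by (simp add: set_ivar_def)
  ultimately have "exec h rank_step s (t + 6) (set_ivar ''j'' 0 (ivar s ''j'' 0 + 1) ?s)"
    by (simp only:)
  moreover have "t + 6 \<le> 70" using t(1) by simp
  ultimately show ?thesis by blast
qed

lemma rank_loop_exec:
  assumes "ivar s0 ''j'' 0 = 0" "ivar s0 ''r'' 0 = 0"
  shows "\<exists>t s. exec h rank_loop s0 t s \<and> t \<le> ivar s0 ''n'' 0 * 76 + 6 \<and> rvar s = rvar s0 \<and>
    ivar s ''r'' 0 = target_pos (state_key s0) (ivar s0 ''n'' 0) (ivar s0 ''i'' 0) \<and>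
    (\<forall>x. x \<noteq> ''j'' \<longrightarrow> x \<noteq> ''r'' \<longrightarrow> ivar s x = ivar s0 x)"
proof -
  let ?n = "ivar s0 ''n'' 0" and ?i = "ivar s0 ''i'' 0"
  let ?b = "ILess (icell ''j'') (icell ''n'')"
  \<comment> \<open>After \<open>k\<close> rounds \<open>r\<close> counts the predecessors of
    \<open>?i\<close> among the indices below \<open>k\<close>, which is \<open>target_pos\<close>
    with \<open>k\<close> in place of \<open>?n\<close>.\<close>
  define I where "I k s \<longleftrightarrow> rvar s = rvar s0 \<and> ivar s ''j'' 0 = k \<and>
    ivar s ''r'' 0 = target_pos (state_key s0) k ?i \<and>
    (\<forall>x. x \<noteq> ''j'' \<longrightarrow> x \<noteq> ''r'' \<longrightarrow> ivar s x = ivar s0 x)" for k and s :: state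
  have "\<exists>t s'. exec h (While ?b rank_step) s0 t s' \<and> t \<le> ?n * (1 + btime ?b + 70) + (1 + btime ?b) \<and>
      I ?n s'"
  proof (rule exec_counting_loop[where I = I])
    fix k s assume k: "k < ?n" and I: "I k s"
    let ?P = "ranks_before (state_key s0) k ?i"
    have key: "state_key s = state_key s0" using I by (simp add: I_def state_key_def fun_eq_iff)
    have "{l. l < Suc k \<and> ranks_before (state_key s0) l ?i} =
        (if ?P then insert k else id) {l. l < k \<and> ranks_before (state_key s0) l ?i}"
      by (auto simp: less_Suc_eq)
    then have "target_pos (state_key s0) (Suc k) ?i = target_pos (state_key s0) k ?i + (if ?P then 1 else 0)"
      by (simp add: target_pos_def)
    then have "I (Suc k) (set_ivar ''j'' 0 (ivar s ''j'' 0 + 1)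
      (if ranks_before (state_key s) (ivar s ''j'' 0) (ivar s ''i'' 0)
       then set_ivar ''r'' 0 (ivar s ''r'' 0 + 1) s else s))"
      using I key by (simp add: I_def set_ivar_def)
    then show "\<exists>t s'. exec h rank_step s t s' \<and> t \<le> 70 \<and> I (Suc k) s'"
      using rank_step_exec[of h s] by blast
  next
    show "bval ?b s \<longleftrightarrow> k < ?n" if "I k s" for k s using that by (simp add: I_def)
    show "I 0 s0" using assms by (simp add: I_def target_pos_def)
  qed
  moreover have "?n * (1 + btime ?b + 70) + (1 + btime ?b) = ?n * 76 + 6" by simp
  ultimately obtain t s where "exec h rank_loop s0 t s" "t \<le> ?n * 76 + 6" "I ?n s"
    unfolding rank_loop_def by (elim exE conjE) (simp only:)
  then show ?thesis unfolding I_def by blast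
qed

lemma place_step_exec:
  fixes s :: state
  defines "i \<equiv> ivar s ''i'' 0" and "r \<equiv> target_pos (state_key s) (ivar s ''n'' 0) (ivar s ''i'' 0)"
  shows "\<exists>t s'. exec h place_step s t s' \<and> t \<le> ivar s ''n'' 0 * 76 + 23 \<and> rvar s' = rvar s \<and>
    ivar s' ''n'' = ivar s ''n'' \<and> ivar s' ''i'' 0 = Suc i \<and> ivar s' ''out'' = (ivar s ''out'')(r := i)"
proof -
  let ?s1 = "set_ivar ''r'' 0 0 s"
  let ?s2 = "set_ivar ''j'' 0 0 ?s1"
  have 1: "exec h (IAssign ''r'' (IConst 0) (IConst 0)) s 3 ?s1"
    by (rule exec_IAssignI) simp_all
  have 2: "exec h (IAssign ''j'' (IConst 0) (IConst 0)) ?s1 3 ?s2"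
    by (rule exec_IAssignI) simp_all
  have rvar: "rvar ?s2 = rvar s" by (simp add: set_ivar_def)
  have same: "ivar ?s2 x = ivar s x" if "x \<noteq> ''j''" "x \<noteq> ''r''" for x
    using that by (simp add: set_ivar_def)
  have zero: "ivar ?s2 ''j'' 0 = 0" "ivar ?s2 ''r'' 0 = 0" by (simp_all add: set_ivar_def)
  have key: "state_key ?s2 = state_key s" by (simp add: fun_eq_iff state_key_def set_ivar_def)
  from rank_loop_exec[OF zero, of h] obtain t3 s3 where
    3: "exec h rank_loop ?s2 t3 s3" "t3 \<le> ivar s ''n'' 0 * 76 + 6" "rvar s3 = rvar s"
      "ivar s3 ''r'' 0 = r" "\<And>x. x \<noteq> ''j'' \<Longrightarrow> x \<noteq> ''r'' \<Longrightarrow> ivar s3 x = ivar s x"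
    by (auto simp: rvar same key r_def)
  let ?s4 = "set_ivar ''out'' r i s3"
  have 4: "exec h (IAssign ''out'' (icell ''r'') (icell ''i'')) s3 5 ?s4"
    using 3(4) 3(5)[of "''i''"] by (intro exec_IAssignI) (simp_all add: i_def)
  let ?s5 = "set_ivar ''i'' 0 (Suc i) ?s4"
  have "ivar ?s4 ''i'' 0 = i" using 3(5)[of "''i''"] by (simp add: set_ivar_def i_def)
  then have 5: "exec h (IAssign ''i'' (IConst 0) (IPlus (icell ''i'') (IConst 1))) ?s4 6 ?s5"
    by (intro exec_IAssignI) simp_all
  have *: "exec h place_step s (3 + (3 + (t3 + (5 + 6)))) ?s5"
    unfolding place_step_def by (intro Seq[OF 1] Seq[OF 2] Seq[OF 3(1)] Seq[OF 4] 5)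
  show ?thesis using 3 * by (intro exI[of _ "3 + (3 + (t3 + (5 + 6)))"] exI[of _ ?s5]) (simp add: set_ivar_def)
qed

text \<open>Each job index is written to its own position, so \<open>out\<close> ends up as a left
  inverse of \<open>target_pos\<close>.\<close>

lemma rank_sort_exec:
  assumes "ivar s0 ''i'' 0 = 0"
  defines "n \<equiv> ivar s0 ''n'' 0"
  shows "\<exists>t s. exec h rank_sort s0 t s \<and> t \<le> n * (n * 76 + 29) + 6 \<and>
    (\<forall>i<n. ivar s ''out'' (target_pos (state_key s0) n i) = i)"
proof -
  let ?b = "ILess (icell ''i'') (icell ''n'')"
  define I where "I k s \<longleftrightarrow> rvar s = rvar s0 \<and> ivar s ''i'' 0 = k \<and> ivar s ''n'' = ivar s0 ''n'' \<and>
    (\<forall>i<k. ivar s ''out'' (target_pos (state_key s0) n i) = i)" for k and s :: state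
  have "\<exists>t s'. exec h (While ?b place_step) s0 t s' \<and>
      t \<le> n * (1 + btime ?b + (n * 76 + 23)) + (1 + btime ?b) \<and> I n s'"
  proof (rule exec_counting_loop[where I = I])
    fix k s assume k: "k < n" and I: "I k s"
    have key: "state_key s = state_key s0" using I by (simp add: I_def state_key_def fun_eq_iff)
    obtain t s' where s': "exec h place_step s t s'" "t \<le> n * 76 + 23" "rvar s' = rvar s"
      "ivar s' ''n'' = ivar s ''n''" "ivar s' ''i'' 0 = Suc k"
      "ivar s' ''out'' = (ivar s ''out'')(target_pos (state_key s0) n k := k)"
      using place_step_exec[of h s] I key by (auto simp: I_def n_def)
    \<comment> \<open>Injectivity ensures that the new entry overwrites none of the earlier
      ones.\<close>
    have "target_pos (state_key s0) n i \<noteq> target_pos (state_key s0) n k" if "i < k" for i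
      using bij_betw_imp_inj_on[OF target_pos_bij[of "state_key s0" n]] that k
      by (auto dest: inj_onD)
    then have "I (Suc k) s'" using I s' by (auto simp: I_def less_Suc_eq)
    with s' show "\<exists>t s'. exec h place_step s t s' \<and> t \<le> n * 76 + 23 \<and> I (Suc k) s'" by blast
  next
    show "bval ?b s \<longleftrightarrow> k < n" if "I k s" for k s using that by (simp add: I_def n_def)
    show "I 0 s0" using assms by (simp add: I_def)
  qed
  moreover have "n * (1 + btime ?b + (n * 76 + 23)) + (1 + btime ?b) = n * (n * 76 + 29) + 6"
    by (simp add: algebra_simps)
  ultimately obtain t s' where "exec h rank_sort s0 t s'" "t \<le> n * (n * 76 + 29) + 6" "I n s'"
    unfolding rank_sort_def by (elim exE conjE) (simp only:)
  then show ?thesis unfolding I_def by blast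
qed

lemma rank_sort_computes:
  fixes p w :: "'a \<Rightarrow> real"
  assumes "distinct js"
  shows "\<exists>\<sigma>. computes_within rank_sort h p w js (length js * (length js * 76 + 29) + 6) \<sigma> \<and>
    \<sigma> \<in> permutations_of_set (set js) \<and>
    sorted_wrt (\<lambda>i j. smith_key p w i \<le> smith_key p w j) \<sigma>"
proof -
  define n where "n = length js"
  let ?s0 = "input_state p w js"
  let ?f = "state_key ?s0"
  have key: "?f i = smith_key p w (js ! i)" if "i < n" for i
    using that by (simp add: state_key_def smith_key_def input_state_def n_def)
  have "ivar ?s0 ''i'' 0 = 0" "ivar ?s0 ''n'' 0 = n" by (simp_all add: input_state_def n_def)
  with rank_sort_exec[of ?s0 h] obtain t s where
    s: "exec h rank_sort ?s0 t s" "t \<le> n * (n * 76 + 29) + 6"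
      "\<And>i. i < n \<Longrightarrow> ivar s ''out'' (target_pos ?f n i) = i"
    by auto
  let ?out = "ivar s ''out''"
  have ex: "\<exists>i<n. k = target_pos ?f n i" if "k < n" for k
  proof -
    have "k \<in> target_pos ?f n ` {..<n}"
      using that by (simp add: bij_betw_imp_surj_on[OF target_pos_bij])
    then show ?thesis by auto
  qed
  \<comment> \<open>As \<open>target_pos\<close> is onto, the left inverse \<open>?out\<close> is
    also a right inverse; hence the output is a permutation and is sorted by key.\<close>
  have out: "?out k < n" "target_pos ?f n (?out k) = k" if "k < n" for k
    using ex[OF that] s(3) by auto
  define \<sigma> where "\<sigma> = map (\<lambda>k. js ! ?out k) [0..<n]"
  have "inj_on ?out {..<n}" by (rule inj_on_inverseI[of _ "target_pos ?f n"]) (simp add: out)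
  then have inj: "inj_on (\<lambda>k. js ! ?out k) (set [0..<n])"
    using assms out(1) by (auto simp: inj_on_def nth_eq_iff_index_eq n_def)
  then have dist: "distinct \<sigma>" by (simp add: \<sigma>_def distinct_map)
  have "set \<sigma> \<subseteq> set js" using out(1) by (auto simp: \<sigma>_def n_def)
  moreover have "card (set \<sigma>) = card (set js)"
    using distinct_card[OF dist] distinct_card[OF assms] by (simp add: \<sigma>_def n_def)
  ultimately have "set \<sigma> = set js" by (intro card_subset_eq) auto
  with dist have "\<sigma> \<in> permutations_of_set (set js)" by (simp add: permutations_of_set_def)
  moreover have "sorted_wrt (\<lambda>i j. smith_key p w i \<le> smith_key p w j) \<sigma>"
  proof (subst sorted_wrt_iff_nth_less, intro allI impI)
    fix a b assume "a < b" "b < length \<sigma>"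
    then have ab: "a < b" "a < n" "b < n" by (simp_all add: \<sigma>_def)
    then have "?f (?out a) \<le> ?f (?out b)"
      by (intro le_of_target_pos_less[of _ n]) (simp_all add: out)
    with ab show "smith_key p w (\<sigma> ! a) \<le> smith_key p w (\<sigma> ! b)"
      by (simp add: \<sigma>_def key out)
  qed
  moreover have "outputs s js \<sigma>" using out(1) by (simp add: outputs_def \<sigma>_def n_def)
  ultimately show ?thesis using s(1,2) unfolding computes_within_def n_def by blast
qed

theorem theorem6:
  shows "\<exists>(c :: com) (q :: nat poly).
    \<forall>(S :: 'a set) (p :: 'a \<Rightarrow> real) (w :: 'a \<Rightarrow> real) (h :: real \<Rightarrow> real).
      valid_jobs S p w \<and> concave_cost h \<longrightarrow>
      (let P = sum p S; \<kappa> = curvature h P in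
        (curvature_quotient h P \<longlongrightarrow> 1 - \<kappa>) (at_left P) \<and>
        (\<forall>h'0 h'P. (h has_real_derivative h'0) (at_right 0) \<and> (h has_real_derivative h'P) (at P)
           \<longrightarrow> 1 - \<kappa> = h'P / h'0) \<and>
        (\<forall>js \<in> permutations_of_set S. \<exists>\<sigma>.
           computes_within c h p w js (poly q (card S)) \<sigma> \<and>
           has_approx_ratio (2 / (2 - \<kappa>)) S p w h \<sigma>))"
proof (intro exI[of _ rank_sort] exI[of _ "[:6, 29, 76:]"] allI impI, elim conjE)
  fix S :: "'a set" and p w :: "'a \<Rightarrow> real" and h :: "real \<Rightarrow> real"
  assume jobs: "valid_jobs S p w" and h: "concave_cost h"
  then have P: "0 < sum p S" by (simp add: valid_jobs_def)
  have "\<exists>\<sigma>. computes_within rank_sort h p w js (poly [:6, 29, 76:] (card S)) \<sigma> \<and>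
      has_approx_ratio (2 / (2 - curvature h (sum p S))) S p w h \<sigma>"
    if "js \<in> permutations_of_set S" for js
  proof -
    from that have js: "distinct js" "set js = S" by (auto simp: permutations_of_set_def)
    \<comment> \<open>The coefficients, constant term first, are those of the quadratic time bound
      of \<open>rank_sort\<close>.\<close>
    then have time: "poly [:6, 29, 76:] (card S) = length js * (length js * 76 + 29) + 6"
      using distinct_card[of js] by (simp add: algebra_simps)
    from rank_sort_computes[OF js(1), of h p w, unfolded js(2)]
    show ?thesis unfolding time using smith_order_approx_ratio[OF jobs h] by blast
  qed
  with curvature_quotient_tendsto(1)[OF h P] curvature_eq_derivative_ratio[OF h P]
  show "let P = sum p S; \<kappa> = curvature h P in
        (curvature_quotient h P \<longlongrightarrow> 1 - \<kappa>) (at_left P) \<and>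
        (\<forall>h'0 h'P. (h has_real_derivative h'0) (at_right 0) \<and> (h has_real_derivative h'P) (at P)
           \<longrightarrow> 1 - \<kappa> = h'P / h'0) \<and>
        (\<forall>js \<in> permutations_of_set S. \<exists>\<sigma>.
           computes_within rank_sort h p w js (poly [:6, 29, 76:] (card S)) \<sigma> \<and>
           has_approx_ratio (2 / (2 - \<kappa>)) S p w h \<sigma>)"
    by (simp add: Let_def)
qed

end
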